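(* Let $\Gamma$ be a signed graph whose underlying graph is the complete graph $K_n$. If $\Gamma$ is a signed nut graph, then $n\equiv 1 \pmod 4$. Moreover, for each positive integer $n\equiv 1\pmod 4$, there exists a signed nut graph with underlying graph $K_n$.
   Context: A signed graph $\Gamma=(G,\Sigma)$ is a finite simple graph $G=(V,E)$ (the underlying graph) with a distinguished set $\Sigma\subseteq E$ of negative edges. Its adjacency matrix $A(\Gamma)$ is obtained from the $0$-$1$ adjacency matrix of $G$ by replacing $1$ by $-1$ at entries corresponding to negative edges. A vector indexed by $V$ is full if it has no zero entry. A signed graph $\Gamma$ is a signed nut graph if $\dim\ker A(\Gamma)=1$ and $\ker A(\Gamma)$ contains a full vector. *)

theory Defs
  imports Complex_Main "HOL-Library.Function_Algebras" "HOL-Number_Theory.Cong"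
begin

definition simple_graph :: "'a set \<Rightarrow> 'a set set \<Rightarrow> bool" where
  "simple_graph V E \<longleftrightarrow> finite V \<and> (\<forall>e\<in>E. e \<subseteq> V \<and> card e = 2)"

definition is_complete_graph :: "nat \<Rightarrow> 'a set \<Rightarrow> 'a set set \<Rightarrow> bool" where
  "is_complete_graph n V E \<longleftrightarrow>
     simple_graph V E \<and> card V = n \<and> (\<forall>u\<in>V. \<forall>v\<in>V. u \<noteq> v \<longrightarrow> {u, v} \<in> E)"

record 'a sgraph =
  verts :: "'a set"
  edges :: "'a set set"
  neg_edges :: "'a set set"

definition signed_graph :: "'a sgraph \<Rightarrow> bool" where
  "signed_graph \<Gamma> \<longleftrightarrow> simple_graph (verts \<Gamma>) (edges \<Gamma>) \<and> neg_edges \<Gamma> \<subseteq> edges \<Gamma>"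

definition adj_matrix :: "'a sgraph \<Rightarrow> 'a \<Rightarrow> 'a \<Rightarrow> real" where
  "adj_matrix \<Gamma> u v =
     (if {u, v} \<in> neg_edges \<Gamma> then - 1 else if {u, v} \<in> edges \<Gamma> then 1 else 0)"

text \<open>
  Vectors indexed by the vertex set \<open>V \<subseteq> UNIV\<close> are represented by functions on the
  whole type that vanish outside \<open>V\<close>, so that each vector has exactly one representative.
\<close>

definition vertex_vectors :: "'a set \<Rightarrow> ('a \<Rightarrow> real) set" where
  "vertex_vectors V = {x. \<forall>v. v \<notin> V \<longrightarrow> x v = 0}"

definition adj_kernel :: "'a sgraph \<Rightarrow> ('a \<Rightarrow> real) set" where
  "adj_kernel \<Gamma> =
     {x \<in> vertex_vectors (verts \<Gamma>).
        \<forall>u\<in>verts \<Gamma>. (\<Sum>v\<in>verts \<Gamma>. adj_matrix \<Gamma> u v * x v) = 0}"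

definition full_vector :: "'a set \<Rightarrow> ('a \<Rightarrow> real) \<Rightarrow> bool" where
  "full_vector V x \<longleftrightarrow> x \<in> vertex_vectors V \<and> (\<forall>v\<in>V. x v \<noteq> 0)"

definition fun_scale :: "real \<Rightarrow> ('a \<Rightarrow> real) \<Rightarrow> 'a \<Rightarrow> real" where
  "fun_scale c x = (\<lambda>v. c * x v)"

global_interpretation fun_space: vector_space "fun_scale :: real \<Rightarrow> ('a \<Rightarrow> real) \<Rightarrow> 'a \<Rightarrow> real"
  by unfold_locales (auto simp: fun_scale_def fun_eq_iff algebra_simps)

lemma subspace_adj_kernel: "fun_space.subspace (adj_kernel \<Gamma>)"
proof (rule fun_space.subspaceI)
  show "0 \<in> adj_kernel \<Gamma>"
    by (simp add: adj_kernel_def vertex_vectors_def)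
next
  fix x y assume "x \<in> adj_kernel \<Gamma>" "y \<in> adj_kernel \<Gamma>"
  then show "x + y \<in> adj_kernel \<Gamma>"
    by (simp add: adj_kernel_def vertex_vectors_def distrib_left sum.distrib)
next
  fix c x assume x: "x \<in> adj_kernel \<Gamma>"
  have "(\<Sum>v\<in>verts \<Gamma>. adj_matrix \<Gamma> u v * (c * x v)) =
        c * (\<Sum>v\<in>verts \<Gamma>. adj_matrix \<Gamma> u v * x v)" for u
    by (simp add: sum_distrib_left mult.left_commute)
  with x show "fun_scale c x \<in> adj_kernel \<Gamma>"
    by (simp add: adj_kernel_def vertex_vectors_def fun_scale_def)
qed

definition signed_nut_graph :: "'a sgraph \<Rightarrow> bool" where
  "signed_nut_graph \<Gamma> \<longleftrightarrow> signed_graph \<Gamma> \<and> fun_space.dim (adj_kernel \<Gamma>) = 1 \<and>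
     (\<exists>x\<in>adj_kernel \<Gamma>. full_vector (verts \<Gamma>) x)"

end

theory Submission imports Defs begin

text \<open>
  Everything rests on one observation modulo two. The adjacency matrix \<open>A\<close> of a signed
  \<open>K\<^sub>n\<close> reduces to the matrix with zero diagonal and all other entries one, so an
  integer vector \<open>y\<close> with \<open>A y = 0\<close> has every \<open>y u\<close> congruent to the sum of all entries: the
  entries share one parity. After division by a power of two they are all odd. A real
  kernel vector \<open>x\<close> yields such a \<open>y\<close> by a \<open>\<rat>\<close>-linear map \<open>\<real> \<rightarrow> \<rat>\<close> applied entrywise, and zeros
  of \<open>x\<close> would remain zeros of \<open>y\<close>; so every nonzero kernel vector is full
  (\<open>odd_integer_kernel_vector\<close>).

  Necessity. The parity of an all-odd \<open>y\<close> equals that of the sum of its \<open>n\<close> entries, which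
  makes \<open>n\<close> odd. The quadratic form of \<open>A\<close> at \<open>y\<close> vanishes and is twice a sum of
  \<open>n (n - 1) / 2\<close> odd numbers, so \<open>4\<close> divides \<open>n (n - 1)\<close>, hence \<open>n - 1\<close>.

  Existence. As all nonzero kernel vectors are full, two of them are always
  proportional: otherwise some nonzero combination would vanish at a vertex. Thus a signed
  complete graph is a nut graph as soon as it is singular (\<open>singular_complete_is_nut\<close>), and it
  suffices that all rows sum to zero. This holds when the sign of an edge \<open>{i, j}\<close>
  depends on \<open>\<bar>i - j\<bar>\<close> in the periodic pattern \<open>- + + -\<close>: a row splits into distances \<open>1, \<dots>, i\<close> and
  \<open>1, \<dots>, n - 1 - i\<close>, whose partial sums cancel because \<open>4\<close> divides \<open>n - 1\<close>.
\<close>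

section \<open>From a real kernel vector to an odd integer one\<close>

text \<open>
  Linear relations with integer coefficients between real numbers survive under \<open>f\<close>. The
  functional is the coordinate at \<open>r\<close> in a Hamel basis of \<open>\<real>\<close> over \<open>\<rat>\<close> that contains \<open>r\<close>.
\<close>

lemma rational_functional:
  fixes r :: real
  assumes "r \<noteq> 0"
  obtains f :: "real \<Rightarrow> rat"
  where "f r = 1" "\<And>x y. f (x + y) = f x + f y" "\<And>m x. f (of_int m * x) = of_int m * f x"
proof -
  interpret Q: vector_space "\<lambda>(q::rat) (x::real). of_rat q * x"
    by unfold_locales (auto simp: algebra_simps of_rat_add of_rat_mult)
  define B where "B = Q.extend_basis {r}"
  have ind1: "Q.independent {r}"
    using assms by (simp add: Q.dependent_single)
  have ind: "Q.independent B"
    unfolding B_def using ind1 by (rule Q.independent_extend_basis)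
  have spn: "x \<in> Q.span B" for x
    unfolding B_def using Q.span_extend_basis[OF ind1] by simp
  have rB: "r \<in> B"
    unfolding B_def using Q.extend_basis_superset[OF ind1] by simp
  show thesis
  proof (rule that[of "\<lambda>x. Q.representation B x r"])
    show "Q.representation B r r = 1"
      using Q.representation_basis[OF ind rB] by simp
    show "Q.representation B (x + y) r = Q.representation B x r + Q.representation B y r" for x y
      by (simp add: Q.representation_add[OF ind spn spn])
    show "Q.representation B (of_int m * x) r = of_int m * Q.representation B x r" for m x
      using Q.representation_scale[OF ind spn, of "of_int m" x] by simp
  qed
qed

lemma common_denominator:
  fixes q :: "'a \<Rightarrow> rat"
  assumes "finite V"
  obtains d :: int and z :: "'a \<Rightarrow> int"
  where "d > 0" "\<And>v. v \<in> V \<Longrightarrow> of_int (z v) = of_int d * q v"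
proof -
  have "\<exists>d>0. \<forall>v\<in>V. \<exists>k::int. of_int k = of_int d * q v"
    using assms
  proof (induction V rule: finite_induct)
    case empty
    show ?case by (intro exI[of _ 1]) auto
  next
    case (insert w V)
    then obtain d where d: "d > 0" "\<forall>v\<in>V. \<exists>k::int. of_int k = of_int d * q v" by blast
    obtain a b where ab: "quotient_of (q w) = (a, b)" by force
    have b: "b > 0" using quotient_of_denom_pos[OF ab] .
    have qw: "q w = of_int a / of_int b" using quotient_of_div[OF ab] .
    show ?case
    proof (rule exI[of _ "b * d"], intro conjI ballI)
      show "b * d > 0" using b d by simp
      fix v assume "v \<in> insert w V"
      then consider "v = w" | "v \<in> V" by blast
      then show "\<exists>k::int. of_int k = of_int (b * d) * q v"
      proof cases
        case 1
        have "of_int (a * d) = of_int (b * d) * q v"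
          using b unfolding 1 qw by simp
        then show ?thesis by blast
      next
        case 2
        then obtain k :: int where "of_int k = of_int d * q v" using d by blast
        then have "of_int (b * k) = of_int (b * d) * q v" by simp
        then show ?thesis by blast
      qed
    qed
  qed
  then obtain d where "d > 0" "\<forall>v\<in>V. \<exists>k::int. of_int k = of_int d * q v" by blast
  then show thesis using that by metis
qed

text \<open>
  Halving strictly decreases \<open>\<bar>z v0\<bar>\<close>, so it stops at a vector that is not even throughout;
  \<open>c\<close> is the power of two removed.
\<close>

lemma halve_to_odd_entry:
  fixes z :: "'a \<Rightarrow> int"
  assumes "v0 \<in> V" "z v0 \<noteq> 0"
  obtains c :: int and y where "c \<noteq> 0" "\<And>v. v \<in> V \<Longrightarrow> z v = c * y v" "\<exists>v\<in>V. odd (y v)"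
proof -
  have "\<exists>c y. c \<noteq> 0 \<and> (\<forall>v\<in>V. z v = c * y v) \<and> (\<exists>v\<in>V. odd (y v))"
    using assms(2)
  proof (induction "nat \<bar>z v0\<bar>" arbitrary: z rule: less_induct)
    case less
    show ?case
    proof (cases "\<exists>v\<in>V. odd (z v)")
      case True
      then show ?thesis by (intro exI[of _ 1] exI[of _ z]) simp
    next
      case False
      define h where "h v = z v div 2" for v
      have h: "z v = 2 * h v" if "v \<in> V" for v
        using False that by (simp add: h_def)
      have "nat \<bar>h v0\<bar> < nat \<bar>z v0\<bar>" "h v0 \<noteq> 0"
        using h[OF assms(1)] less.prems by auto
      then obtain c y where cy: "c \<noteq> 0" "\<forall>v\<in>V. h v = c * y v" "\<exists>v\<in>V. odd (y v)"
        using less.hyps by blast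
      then show ?thesis
        using h by (intro exI[of _ "2 * c"] exI[of _ y]) auto
    qed
  qed
  then show thesis using that by blast
qed

text \<open>
  Modulo two, row \<open>u\<close> of the system reads \<open>(\<Sum>v\<in>V - {u}. y v) = 0\<close>. The right-hand side of the
  equivalence does not mention \<open>u\<close>, so the entries of an integer kernel vector have
  a common parity.
\<close>

lemma kernel_mod_two_constant:
  fixes a :: "'a \<Rightarrow> 'a \<Rightarrow> int"
  assumes V: "finite V"
    and diag: "\<And>u. u \<in> V \<Longrightarrow> a u u = 0"
    and off: "\<And>u v. u \<in> V \<Longrightarrow> v \<in> V \<Longrightarrow> u \<noteq> v \<Longrightarrow> odd (a u v)"
    and u: "u \<in> V" and ker: "(\<Sum>v\<in>V. a u v * y v) = 0"
  shows "even (y u) \<longleftrightarrow> even (\<Sum>v\<in>V. y v)"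
proof -
  have "even (\<Sum>v\<in>V - {u}. (a u v - 1) * y v)"
    using off u by (intro dvd_sum) auto
  then have "even ((\<Sum>v\<in>V - {u}. a u v * y v) - (\<Sum>v\<in>V - {u}. y v))"
    by (simp add: left_diff_distrib sum_subtractf)
  moreover have "(\<Sum>v\<in>V - {u}. a u v * y v) = 0"
    using ker diag[OF u] by (simp add: sum.remove[OF V u])
  ultimately show ?thesis
    by (simp add: sum.remove[OF V u])
qed

text \<open>
  The map from \<open>x\<close> to \<open>y\<close> (functional, common denominator, powers of two) is linear over the
  integers and therefore preserves both the kernel and zero entries. Since no entry
  of \<open>y\<close> is zero, neither is any entry of \<open>x\<close>.
\<close>

lemma odd_integer_kernel_vector:
  fixes a :: "'a \<Rightarrow> 'a \<Rightarrow> int" and x :: "'a \<Rightarrow> real"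
  assumes V: "finite V"
    and diag: "\<And>u. u \<in> V \<Longrightarrow> a u u = 0"
    and off: "\<And>u v. u \<in> V \<Longrightarrow> v \<in> V \<Longrightarrow> u \<noteq> v \<Longrightarrow> odd (a u v)"
    and ker: "\<And>u. u \<in> V \<Longrightarrow> (\<Sum>v\<in>V. of_int (a u v) * x v) = 0"
    and w: "w \<in> V" "x w \<noteq> 0"
  obtains y :: "'a \<Rightarrow> int"
  where "\<And>v. v \<in> V \<Longrightarrow> odd (y v)" "\<And>u. u \<in> V \<Longrightarrow> (\<Sum>v\<in>V. a u v * y v) = 0"
    "\<And>v. v \<in> V \<Longrightarrow> x v \<noteq> 0"
proof -
  \<comment> \<open>Normalising \<open>f\<close> at \<open>x w\<close> keeps the image vector nonzero.\<close>
  obtain f :: "real \<Rightarrow> rat" where f: "f (x w) = 1" "\<And>s t. f (s + t) = f s + f t"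
      "\<And>m t. f (of_int m * t) = of_int m * f t"
    using rational_functional[OF w(2)] by blast
  have f0: "f 0 = 0" using f(3)[of 0 0] by simp
  have fsum: "f (\<Sum>v\<in>V. g v) = (\<Sum>v\<in>V. f (g v))" for g
    using V by (induction V rule: finite_induct) (simp_all add: f0 f(2))
  obtain d z where d: "d > 0" and z: "\<And>v. v \<in> V \<Longrightarrow> of_int (z v) = of_int d * f (x v)"
    using common_denominator[OF V, of "\<lambda>v. f (x v)"] by blast
  have "of_int (z w) = (of_int d :: rat)" using z[OF w(1)] f(1) by simp
  then have zw: "z w \<noteq> 0" using d by simp
  obtain c y where c: "c \<noteq> 0" and y: "\<And>v. v \<in> V \<Longrightarrow> z v = c * y v" and oddy: "\<exists>v\<in>V. odd (y v)"
    using halve_to_odd_entry[of w V z] w(1) zw by blast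
  have kery: "(\<Sum>v\<in>V. a u v * y v) = 0" if u: "u \<in> V" for u
  proof -
    have "of_int (\<Sum>v\<in>V. a u v * z v) = (\<Sum>v\<in>V. of_int d * f (of_int (a u v) * x v))"
      unfolding of_int_sum by (rule sum.cong) (simp_all add: z f(3))
    also have "\<dots> = of_int d * f (\<Sum>v\<in>V. of_int (a u v) * x v)"
      by (simp add: fsum sum_distrib_left)
    also have "\<dots> = 0" using ker[OF u] by (simp add: f0)
    finally have "(\<Sum>v\<in>V. a u v * z v) = 0" by (simp only: of_int_eq_0_iff)
    moreover have "(\<Sum>v\<in>V. a u v * z v) = c * (\<Sum>v\<in>V. a u v * y v)"
      unfolding sum_distrib_left by (rule sum.cong) (simp_all add: y)
    ultimately show ?thesis using c by simp
  qed
  have all_odd: "odd (y v)" if "v \<in> V" for v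
    using kernel_mod_two_constant[OF V diag off _ kery] oddy that by blast
  have "x v \<noteq> 0" if v: "v \<in> V" for v
  proof
    assume "x v = 0"
    then have "z v = 0" using z[OF v] f0 by simp
    then show False using y[OF v] c all_odd[OF v] by simp
  qed
  with all_odd kery that show thesis by blast
qed

text \<open>
  Each unordered pair contributes twice an odd number, that is \<open>2\<close> modulo four, and there
  are \<open>card V * (card V - 1) / 2\<close> pairs.
\<close>

lemma sum_symmetric_offdiag:
  fixes g :: "'a \<Rightarrow> 'a \<Rightarrow> int"
  assumes V: "finite V"
    and diag: "\<And>u. u \<in> V \<Longrightarrow> g u u = 0"
    and sym: "\<And>u v. u \<in> V \<Longrightarrow> v \<in> V \<Longrightarrow> g u v = g v u"
    and off: "\<And>u v. u \<in> V \<Longrightarrow> v \<in> V \<Longrightarrow> u \<noteq> v \<Longrightarrow> odd (g u v)"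
  shows "[(\<Sum>u\<in>V. \<Sum>v\<in>V. g u v) = int (card V) * (int (card V) - 1)] (mod 4)"
  using assms
proof (induction V rule: finite_induct)
  case empty
  show ?case by simp
next
  case (insert w V)
  let ?S = "\<Sum>u\<in>V. \<Sum>v\<in>V. g u v" and ?r = "\<Sum>v\<in>V. g w v" and ?n = "int (card V)"
  have "even (\<Sum>v\<in>V. g w v - 1)"
  proof (rule dvd_sum)
    fix v assume "v \<in> V"
    then have "odd (g w v)" using insert.hyps by (intro insert.prems(3)) auto
    then show "even (g w v - 1)" by simp
  qed
  then have "even (?r - ?n)"
    by (simp add: sum_subtractf)
  then have "2 * 2 dvd 2 * (?r - ?n)" by (rule mult_dvd_mono[OF dvd_refl])
  then have "4 dvd 2 * (?r - ?n)" by simp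
  moreover have "4 dvd ?S - ?n * (?n - 1)"
    using insert by (simp add: cong_iff_dvd_diff)
  ultimately have "4 dvd (?S - ?n * (?n - 1)) + 2 * (?r - ?n)" by (rule dvd_add[rotated])
  moreover have "(\<Sum>u\<in>insert w V. \<Sum>v\<in>insert w V. g u v) = ?S + 2 * ?r"
  proof -
    have "(\<Sum>u\<in>V. g u w) = ?r"
      using insert.prems(2) by (intro sum.cong) auto
    moreover have "g w w = 0" using insert.prems(1) by simp
    ultimately show ?thesis
      using insert.hyps by (simp add: sum.distrib)
  qed
  moreover have "int (card (insert w V)) = ?n + 1"
    using insert.hyps by simp
  ultimately show ?case
    by (simp only: cong_iff_dvd_diff) (simp add: algebra_simps)
qed

section \<open>Signed complete graphs\<close>

text \<open>The adjacency matrix over the integers, where parity makes sense.\<close>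

definition sign_entry :: "'a sgraph \<Rightarrow> 'a \<Rightarrow> 'a \<Rightarrow> int" where
  "sign_entry \<Gamma> u v =
     (if {u, v} \<in> neg_edges \<Gamma> then - 1 else if {u, v} \<in> edges \<Gamma> then 1 else 0)"

lemma adj_matrix_eq_sign_entry: "adj_matrix \<Gamma> u v = of_int (sign_entry \<Gamma> u v)"
  by (simp add: adj_matrix_def sign_entry_def)

lemma sign_entry_commute: "sign_entry \<Gamma> u v = sign_entry \<Gamma> v u"
  by (simp add: sign_entry_def insert_commute)

lemma sign_entry_diag:
  assumes "signed_graph \<Gamma>" shows "sign_entry \<Gamma> u u = 0"
  using assms by (fastforce simp: sign_entry_def signed_graph_def simple_graph_def)

lemma odd_sign_entry:
  assumes "is_complete_graph n (verts \<Gamma>) (edges \<Gamma>)"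
    and "u \<in> verts \<Gamma>" "v \<in> verts \<Gamma>" "u \<noteq> v"
  shows "odd (sign_entry \<Gamma> u v)"
  using assms by (simp add: sign_entry_def is_complete_graph_def)

lemma complete_kernel_vector:
  assumes \<Gamma>: "signed_graph \<Gamma>" "is_complete_graph n (verts \<Gamma>) (edges \<Gamma>)"
    and x: "x \<in> adj_kernel \<Gamma>" "x \<noteq> 0"
  obtains y :: "'a \<Rightarrow> int"
  where "\<And>v. v \<in> verts \<Gamma> \<Longrightarrow> odd (y v)"
    "\<And>u. u \<in> verts \<Gamma> \<Longrightarrow> (\<Sum>v\<in>verts \<Gamma>. sign_entry \<Gamma> u v * y v) = 0"
    "full_vector (verts \<Gamma>) x"
proof -
  have V: "finite (verts \<Gamma>)"
    using \<Gamma>(1) by (simp add: signed_graph_def simple_graph_def)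
  obtain w where "x w \<noteq> 0" using x(2) by (auto simp: fun_eq_iff)
  moreover from this have "w \<in> verts \<Gamma>"
    using x(1) by (auto simp: adj_kernel_def vertex_vectors_def)
  ultimately obtain y where y: "\<And>v. v \<in> verts \<Gamma> \<Longrightarrow> odd (y v)"
    "\<And>u. u \<in> verts \<Gamma> \<Longrightarrow> (\<Sum>v\<in>verts \<Gamma>. sign_entry \<Gamma> u v * y v) = 0"
    "\<And>v. v \<in> verts \<Gamma> \<Longrightarrow> x v \<noteq> 0"
    using odd_integer_kernel_vector[of "verts \<Gamma>" "sign_entry \<Gamma>" x w] V
      sign_entry_diag[OF \<Gamma>(1)] odd_sign_entry[OF \<Gamma>(2)] x(1)
    unfolding adj_kernel_def adj_matrix_eq_sign_entry by auto
  then show thesis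
    using that x(1) by (auto simp: full_vector_def adj_kernel_def)
qed

text \<open>
  A row equation has \<open>n - 1\<close> odd terms and the quadratic form at \<open>y\<close> has \<open>n (n - 1) / 2\<close>
  pairs of equal odd terms. Both vanish, so both counts are even.
\<close>

lemma singular_complete_order:
  fixes \<Gamma> :: "'a sgraph"
  assumes \<Gamma>: "signed_graph \<Gamma>" "is_complete_graph n (verts \<Gamma>) (edges \<Gamma>)"
    and x: "x \<in> adj_kernel \<Gamma>" "x \<noteq> 0"
  shows "[n = 1] (mod 4)"
proof -
  let ?V = "verts \<Gamma>"
  have V: "finite ?V" and n: "card ?V = n"
    using \<Gamma> by (simp_all add: is_complete_graph_def simple_graph_def)
  obtain y :: "'a \<Rightarrow> int" where y: "\<And>v. v \<in> ?V \<Longrightarrow> odd (y v)"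
    and ker: "\<And>u. u \<in> ?V \<Longrightarrow> (\<Sum>v\<in>?V. sign_entry \<Gamma> u v * y v) = 0"
    using complete_kernel_vector[OF \<Gamma> x] by blast
  obtain w where w: "w \<in> ?V"
    using x by (force simp: adj_kernel_def vertex_vectors_def fun_eq_iff)
  have "odd (\<Sum>v\<in>?V. y v)"
    using kernel_mod_two_constant[OF V sign_entry_diag[OF \<Gamma>(1)] odd_sign_entry[OF \<Gamma>(2)] w ker[OF w]]
      y[OF w] by simp
  moreover have "even ((\<Sum>v\<in>?V. y v) - int n)"
  proof -
    have "even (\<Sum>v\<in>?V. y v - 1)" using y by (intro dvd_sum) auto
    then show ?thesis by (simp add: sum_subtractf n)
  qed
  ultimately have "odd n" by simp
  \<comment> \<open>The entries of \<open>g\<close> are the terms of the quadratic form of the adjacency matrix at \<open>y\<close>.\<close>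
  define g where "g u v = y u * sign_entry \<Gamma> u v * y v" for u v
  have "(\<Sum>v\<in>?V. g u v) = 0" if "u \<in> ?V" for u
    using ker[OF that] by (simp add: g_def mult.assoc flip: sum_distrib_left)
  then have "(\<Sum>u\<in>?V. \<Sum>v\<in>?V. g u v) = 0" by simp
  moreover have "[(\<Sum>u\<in>?V. \<Sum>v\<in>?V. g u v) = int n * (int n - 1)] (mod 4)"
    unfolding n[symmetric]
  proof (rule sum_symmetric_offdiag[OF V])
    show "g u u = 0" for u by (simp add: g_def sign_entry_diag[OF \<Gamma>(1)])
    show "g u v = g v u" for u v by (simp add: g_def sign_entry_commute[of \<Gamma> u v])
    show "odd (g u v)" if "u \<in> ?V" "v \<in> ?V" "u \<noteq> v" for u v
      using y[OF that(1)] y[OF that(2)] odd_sign_entry[OF \<Gamma>(2) that] by (simp add: g_def)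
  qed
  ultimately have "4 dvd int n * (int n - 1)"
    by (simp add: cong_iff_dvd_diff)
  moreover have "coprime 4 (int n)"
    using \<open>odd n\<close> coprime_power_left_iff[of 2 2 "int n"] by simp
  ultimately have "4 dvd int n - 1"
    using coprime_dvd_mult_right_iff by blast
  then have "[int n = int 1] (mod int 4)"
    by (simp add: cong_iff_dvd_diff)
  then show ?thesis by (simp only: cong_int_iff)
qed

text \<open>
  The nonzero vector has to come from the dimension: with no vertices at all, the zero
  vector would count as full.
\<close>

lemma signed_nut_kernel_nonzero:
  assumes "signed_nut_graph \<Gamma>"
  obtains x where "x \<in> adj_kernel \<Gamma>" "x \<noteq> 0"
proof -
  have "\<not> adj_kernel \<Gamma> \<subseteq> {0}"
  proof
    assume "adj_kernel \<Gamma> \<subseteq> {0}"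
    then have "fun_space.dim (adj_kernel \<Gamma>) \<le> 0"
      using fun_space.dim_le_card[of "adj_kernel \<Gamma>" "{}"] by simp
    with assms show False by (simp add: signed_nut_graph_def)
  qed
  then show thesis using that by blast
qed

text \<open>
  Fullness of all nonzero kernel vectors forces dimension one: subtracting the multiple
  of \<open>x\<close> that clears the entry at one vertex leaves a kernel vector that is not full, hence zero.
\<close>

lemma singular_complete_is_nut:
  assumes \<Gamma>: "signed_graph \<Gamma>" "is_complete_graph n (verts \<Gamma>) (edges \<Gamma>)"
    and x: "x \<in> adj_kernel \<Gamma>" "x \<noteq> 0"
  shows "signed_nut_graph \<Gamma>"
proof -
  have full: "full_vector (verts \<Gamma>) z" if "z \<in> adj_kernel \<Gamma>" "z \<noteq> 0" for z
    using complete_kernel_vector[OF \<Gamma> that] by blast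
  obtain w where w: "w \<in> verts \<Gamma>"
    using x by (force simp: adj_kernel_def vertex_vectors_def fun_eq_iff)
  have xw: "x w \<noteq> 0" using full[OF x] w by (simp add: full_vector_def)
  have "z \<in> fun_space.span {x}" if z: "z \<in> adj_kernel \<Gamma>" for z
  proof -
    define t where "t = z - fun_scale (z w / x w) x"
    have "t \<in> adj_kernel \<Gamma>"
      unfolding t_def using subspace_adj_kernel[of \<Gamma>] x(1) z
      by (intro fun_space.subspace_diff fun_space.subspace_scale)
    moreover have "t w = 0" using xw by (simp add: t_def fun_scale_def)
    ultimately have "t = 0" using full[of t] w by (auto simp: full_vector_def)
    then have "z = fun_scale (z w / x w) x" by (simp add: t_def)
    then show ?thesis
      by (metis fun_space.span_base fun_space.span_scale singletonI)
  qed
  then have "fun_space.dim (adj_kernel \<Gamma>) = card {x}"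
    using x by (intro fun_space.dim_unique[of "{x}"]) (auto simp: fun_space.dependent_single)
  then show ?thesis
    using \<Gamma>(1) x(1) full[OF x] by (auto simp: signed_nut_graph_def)
qed

section \<open>A singular signed complete graph of each order congruent to one modulo four\<close>

definition distance_signed_complete :: "nat \<Rightarrow> nat sgraph" where
  "distance_signed_complete n =
     \<lparr>verts = {..<n}, edges = {{i, j} |i j. i < j \<and> j < n},
      neg_edges = {{i, j} |i j. i < j \<and> j < n \<and> (j - i) mod 4 < 2}\<rparr>"

text \<open>
  For \<open>d = 1, 2, \<dots>\<close> the signs run \<open>- + + - - + + -\<close> and so on: each block of four sums to zero, and the
  partial sums at \<open>m\<close> and at any \<open>m'\<close> with \<open>4\<close> dividing \<open>m + m'\<close> are opposite.
\<close>

definition distance_sign :: "nat \<Rightarrow> int" where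
  "distance_sign d = (if d mod 4 < 2 then - 1 else 1)"

lemma sum_distance_sign:
  "(\<Sum>d\<in>{1..m}. distance_sign d) =
     (if m mod 4 = 1 then - 1 else if m mod 4 = 3 then 1 else 0)"
proof (induction m)
  case 0
  show ?case by simp
next
  case (Suc m)
  have "m mod 4 < 4" by simp
  then consider "m mod 4 = 0" | "m mod 4 = 1" | "m mod 4 = 2" | "m mod 4 = 3" by linarith
  then show ?case
    by cases (simp_all add: Suc.IH[unfolded One_nat_def] distance_sign_def[of "Suc m"] mod_Suc)
qed

lemma distance_signed_complete_graph:
  "signed_graph (distance_signed_complete n)"
  "is_complete_graph n (verts (distance_signed_complete n)) (edges (distance_signed_complete n))"
proof -
  have "simple_graph {..<n} {{i, j} |i j. i < j \<and> j < n}"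
    by (auto simp: simple_graph_def)
  moreover have "{u, v} \<in> {{i, j} |i j. i < j \<and> j < n}" if "u < n" "v < n" "u \<noteq> v" for u v
    using that by (cases u v rule: linorder_cases) (auto simp: doubleton_eq_iff)
  ultimately show "signed_graph (distance_signed_complete n)"
    "is_complete_graph n (verts (distance_signed_complete n)) (edges (distance_signed_complete n))"
    by (auto simp: signed_graph_def is_complete_graph_def distance_signed_complete_def)
qed

lemma sign_entry_distance_signed_complete:
  assumes "i < j" "j < n"
  shows "sign_entry (distance_signed_complete n) i j = distance_sign (j - i)"
    "sign_entry (distance_signed_complete n) j i = distance_sign (j - i)"
  using assms
  by (auto simp: sign_entry_def distance_signed_complete_def distance_sign_def doubleton_eq_iff)

lemma distance_signed_complete_row_sum:
  assumes n: "[n = 1] (mod 4)" and i: "i < n"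
  shows "(\<Sum>j<n. sign_entry (distance_signed_complete n) i j) = 0"
proof -
  let ?a = "sign_entry (distance_signed_complete n) i"
  have "{..<n} = insert i ({..<i} \<union> {i<..<n})" using i by auto
  then have "(\<Sum>j<n. ?a j) = sum ?a (insert i ({..<i} \<union> {i<..<n}))" by (simp only:)
  also have "\<dots> = ?a i + sum ?a ({..<i} \<union> {i<..<n})"
    by (rule sum.insert) auto
  also have "sum ?a ({..<i} \<union> {i<..<n}) = (\<Sum>j<i. ?a j) + (\<Sum>j\<in>{i<..<n}. ?a j)"
    by (rule sum.union_disjoint) auto
  also have "?a i = 0"
    by (rule sign_entry_diag[OF distance_signed_complete_graph(1)])
  also have "(\<Sum>j<i. ?a j) = (\<Sum>d\<in>{1..i}. distance_sign d)"
    using i by (intro sum.reindex_bij_witness[of _ "\<lambda>d. i - d" "\<lambda>j. i - j"])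
      (auto simp: sign_entry_distance_signed_complete)
  also have "(\<Sum>j\<in>{i<..<n}. ?a j) = (\<Sum>d\<in>{1..n - 1 - i}. distance_sign d)"
    by (intro sum.reindex_bij_witness[of _ "\<lambda>d. i + d" "\<lambda>j. j - i"])
      (auto simp: sign_entry_distance_signed_complete)
  finally have sum: "(\<Sum>j<n. ?a j) =
      (\<Sum>d\<in>{1..i}. distance_sign d) + (\<Sum>d\<in>{1..n - 1 - i}. distance_sign d)"
    by simp
  obtain q where q: "n = Suc (i + q)" using less_imp_Suc_add[OF i] by blast
  have "Suc (i + q) mod 4 = 1" using n unfolding q by (simp add: cong_def)
  then have "i mod 4 = 0 \<and> q mod 4 = 0 \<or> i mod 4 = 1 \<and> q mod 4 = 3 \<or>
      i mod 4 = 2 \<and> q mod 4 = 2 \<or> i mod 4 = 3 \<and> q mod 4 = 1"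
    by presburger
  then have "(\<Sum>d\<in>{1..i}. distance_sign d) + (\<Sum>d\<in>{1..q}. distance_sign d) = 0"
    unfolding sum_distance_sign by (elim disjE conjE) (simp_all only:, simp_all)
  moreover have "n - 1 - i = q" using q by simp
  ultimately show ?thesis unfolding sum by simp
qed

lemma distance_signed_complete_nut:
  assumes "[n = 1] (mod 4)"
  shows "signed_nut_graph (distance_signed_complete n)"
proof (rule singular_complete_is_nut)
  let ?one = "\<lambda>v. if v < n then 1 else 0 :: real"
  have verts: "verts (distance_signed_complete n) = {..<n}"
    by (simp add: distance_signed_complete_def)
  have "(\<Sum>v<n. adj_matrix (distance_signed_complete n) u v * ?one v) = 0" if "u < n" for u
  proof -
    have "(\<Sum>v<n. adj_matrix (distance_signed_complete n) u v * ?one v) =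
        of_int (\<Sum>v<n. sign_entry (distance_signed_complete n) u v)"
      by (simp add: adj_matrix_eq_sign_entry)
    then show ?thesis
      by (simp only: distance_signed_complete_row_sum[OF assms that] of_int_0)
  qed
  then show "?one \<in> adj_kernel (distance_signed_complete n)"
    by (simp add: adj_kernel_def vertex_vectors_def verts)
  have "n \<noteq> 0" using assms by (auto simp: cong_def)
  then show "?one \<noteq> 0" by (auto simp: fun_eq_iff)
qed (rule distance_signed_complete_graph)+

theorem theorem10:
  "(\<forall>(n::nat) (\<Gamma> :: 'a sgraph).
      signed_graph \<Gamma> \<longrightarrow> is_complete_graph n (verts \<Gamma>) (edges \<Gamma>) \<longrightarrow>
      signed_nut_graph \<Gamma> \<longrightarrow> [n = 1] (mod 4)) \<and>
   (\<forall>n::nat. 0 < n \<longrightarrow> [n = 1] (mod 4) \<longrightarrow>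
      (\<exists>\<Gamma> :: nat sgraph.
         is_complete_graph n (verts \<Gamma>) (edges \<Gamma>) \<and> signed_nut_graph \<Gamma>))"
proof (intro conjI allI impI)
  fix n :: nat and \<Gamma> :: "'a sgraph"
  assume "signed_graph \<Gamma>" "is_complete_graph n (verts \<Gamma>) (edges \<Gamma>)" "signed_nut_graph \<Gamma>"
  then show "[n = 1] (mod 4)"
    using signed_nut_kernel_nonzero singular_complete_order by metis
next
  fix n :: nat
  assume "[n = 1] (mod 4)"
  then show "\<exists>\<Gamma> :: nat sgraph.
      is_complete_graph n (verts \<Gamma>) (edges \<Gamma>) \<and> signed_nut_graph \<Gamma>"
    using distance_signed_complete_graph(2) distance_signed_complete_nut by blast
qed

end
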